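(* Consider the Dirichlet eigenvalue problem $\Delta u + \lambda u = 0$ in $D = (0,\pi)\times(0,\pi)$, $u = 0$ on $\partial D$. (i) For every integer $k \ge 1$ there exists an eigenvalue $N$ whose multiplicity is $2k$; in fact one can take $N = p_1 p_2^{k-1}$, where $p_1, p_2$ are distinct primes with $p_1 \equiv p_2 \equiv 1 \pmod 4$. (ii) For every integer $k \ge 1$ there exists an eigenvalue $M$ whose multiplicity is $2k+1$; in fact one can take $M = 2p^{2k}$, where $p$ is a prime with $p \equiv 1 \pmod 4$.
   Context: The eigenvalues of this problem are exactly the numbers $\lambda = n^2 + m^2$ with $n, m$ positive integers, with eigenfunctions $\sin(nx)\sin(my)$. The multiplicity of an eigenvalue $\lambda$ is the dimension of its eigenspace, which equals the number of ordered pairs $(n,m)$ of positive integers with $n^2 + m^2 = \lambda$. *)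

theory Defs
  imports
    "HOL-Analysis.Analysis"
    "HOL-Library.Function_Algebras"
    "HOL-Number_Theory.Number_Theory"
begin

definition square_domain :: "(real \<times> real) set" where
  "square_domain = {0<..<pi} \<times> {0<..<pi}"

definition partial_x :: "(real \<times> real \<Rightarrow> real) \<Rightarrow> real \<times> real \<Rightarrow> real" where
  "partial_x u = (\<lambda>(x, y). deriv (\<lambda>t. u (t, y)) x)"

definition partial_y :: "(real \<times> real \<Rightarrow> real) \<Rightarrow> real \<times> real \<Rightarrow> real" where
  "partial_y u = (\<lambda>(x, y). deriv (\<lambda>t. u (x, t)) y)"

text \<open>Meant for open \<open>S\<close>. Since \<open>deriv\<close> is total, the existence of the partial derivatives
  has to be required separately from their continuity.\<close>

definition C1_on :: "(real \<times> real) set \<Rightarrow> (real \<times> real \<Rightarrow> real) \<Rightarrow> bool" where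
  "C1_on S u \<longleftrightarrow>
     (\<forall>(x, y)\<in>S. (\<lambda>t. u (t, y)) field_differentiable (at x) \<and>
                 (\<lambda>t. u (x, t)) field_differentiable (at y)) \<and>
     continuous_on S (partial_x u) \<and> continuous_on S (partial_y u)"

definition C2_on :: "(real \<times> real) set \<Rightarrow> (real \<times> real \<Rightarrow> real) \<Rightarrow> bool" where
  "C2_on S u \<longleftrightarrow> C1_on S u \<and> C1_on S (partial_x u) \<and> C1_on S (partial_y u)"

definition laplacian :: "(real \<times> real \<Rightarrow> real) \<Rightarrow> real \<times> real \<Rightarrow> real" where
  "laplacian u z = partial_x (partial_x u) z + partial_y (partial_y u) z"

text \<open>Classical solutions: \<open>C\<^sup>2\<close> in the open square and continuous up to the boundary.\<close>

definition dirichlet_solution :: "real \<Rightarrow> (real \<times> real \<Rightarrow> real) \<Rightarrow> bool" where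
  "dirichlet_solution l u \<longleftrightarrow>
     C2_on square_domain u \<and> continuous_on (closure square_domain) u \<and>
     (\<forall>z\<in>square_domain. laplacian u z + l * u z = 0) \<and>
     (\<forall>z\<in>frontier square_domain. u z = 0)"

text \<open>A function on the closed square is represented by the total function extending it by 0,
  so that distinct elements of the eigenspace differ on the closed square.\<close>

definition dirichlet_eigenspace :: "real \<Rightarrow> (real \<times> real \<Rightarrow> real) set" where
  "dirichlet_eigenspace l =
     {u. dirichlet_solution l u \<and> (\<forall>z. z \<notin> closure square_domain \<longrightarrow> u z = 0)}"

definition dirichlet_eigenvalue :: "real \<Rightarrow> bool" where
  "dirichlet_eigenvalue l \<longleftrightarrow> (\<exists>u\<in>dirichlet_eigenspace l. u \<noteq> (\<lambda>z. 0))"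

definition fun_scale :: "real \<Rightarrow> ('a \<Rightarrow> real) \<Rightarrow> 'a \<Rightarrow> real" where
  "fun_scale c u = (\<lambda>z. c * u z)"

interpretation real_fun: vector_space "fun_scale :: real \<Rightarrow> ('a \<Rightarrow> real) \<Rightarrow> 'a \<Rightarrow> real"
  by unfold_locales (auto simp: fun_scale_def fun_eq_iff algebra_simps)

text \<open>The library's \<open>dim\<close> is 0 for an infinite-dimensional space, so a positive value also
  says that the eigenspace is finite-dimensional.\<close>

definition eigen_multiplicity :: "real \<Rightarrow> nat" where
  "eigen_multiplicity l = real_fun.dim (dirichlet_eigenspace l)"

end

theory Submission
  imports Defs
begin

text \<open>A classical solution has vanishing double sine coefficients except at the pairs \<open>(n, m)\<close> with
  \<open>n\<^sup>2 + m\<^sup>2 = \<lambda>\<close>, by Green's identity on slightly smaller squares. As the sine system is complete, the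
  eigenspace is spanned by the corresponding products of sines, which are orthogonal, so the
  multiplicity of an integer \<open>N\<close> is the number of its representations as a sum of two positive squares.
  Writing \<open>R\<close> for the number of all integer representations, multiplication by \<open>\<pi>\<close> and its conjugate,
  where \<open>p = \<pi> * cnj \<pi>\<close> is a prime congruent to 1 modulo 4, yields
  \<open>R (p * M) + R (M / p) = 2 * R M\<close> (the second term is absent if \<open>p\<close> does not divide \<open>M\<close>), hence
  \<open>R (p ^ j * M) = (j + 1) * R M\<close> for \<open>M\<close> prime to \<open>p\<close>. For a nonsquare, exactly a quarter of the
  representations are positive.\<close>

section \<open>Sums of two squares\<close>

text \<open>Euler's criterion gives a square root \<open>t\<close> of -1 modulo \<open>p\<close>.
  Two small integers \<open>x\<close> and \<open>y\<close>, not both zero, with \<open>x\<close>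
  congruent to \<open>t * y\<close> then make the sum of their squares a multiple of
  \<open>p\<close> strictly between 0 and \<open>2 * p\<close>.\<close>

lemma sum_two_squares_prime:
  fixes p :: nat
  assumes p: "prime p" and p1: "[p = 1] (mod 4)"
  shows "\<exists>a b :: int. a\<^sup>2 + b\<^sup>2 = int p"
proof -
  have "p mod 4 = 1" using p1 by (simp add: cong_def)
  hence p2: "2 < p" using p prime_ge_2_nat[of p] by (cases "p = 2") auto
  have "even ((p - 1) div 2)" using \<open>p mod 4 = 1\<close> by presburger
  hence "[Legendre (-1) (int p) = 1] (mod int p)"
    using euler_criterion[OF p p2, of "-1"] by simp
  \<comment> \<open>A Legendre symbol is -1, 0 or 1, and 1 is congruent to neither of the others
    modulo \<open>p > 2\<close>.\<close>
  hence "Legendre (-1) (int p) = 1"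
    using p2 unfolding Legendre_def cong_def
    by (auto split: if_splits simp: zmod_minus1)
  hence "QuadRes (int p) (-1)" by (auto simp: Legendre_def split: if_splits)
  then obtain t where t: "[t\<^sup>2 = -1] (mod int p)" by (auto simp: QuadRes_def)
  \<comment> \<open>Thue's pigeonhole argument on \<open>i - t * j\<close> modulo \<open>p\<close>\<close>
  define s where "s = nat \<lfloor>sqrt (real p)\<rfloor>"
  have s_le: "s\<^sup>2 \<le> p"
  proof -
    have "real s \<le> sqrt (real p)" unfolding s_def by simp
    hence "(real s)\<^sup>2 \<le> (sqrt (real p))\<^sup>2" by (intro power_mono) simp_all
    hence "real (s\<^sup>2) \<le> real p" by simp
    thus ?thesis by (simp only: of_nat_le_iff)
  qed
  \<comment> \<open>A prime is not a square. The strict inequality obtained from this rules out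
    \<open>c = 2\<close> at the end.\<close>
  have "s\<^sup>2 \<noteq> p" using p by (metis prime_power_iff numeral_eq_one_iff semiring_norm(85))
  hence s_lt: "s\<^sup>2 < p" using s_le by simp
  have s_gt: "p < (s + 1)\<^sup>2"
  proof -
    have "sqrt (real p) < real (s + 1)" unfolding s_def by linarith
    hence "real p < (real (s + 1))\<^sup>2" by (metis of_nat_0_le_iff real_sqrt_less_iff real_sqrt_unique)
    thus ?thesis by (metis of_nat_less_iff of_nat_power)
  qed
  define h where "h = (\<lambda>(i, j). (int i - t * int j) mod int p)"
  have "h ` ({..s} \<times> {..s}) \<subseteq> {0..<int p}" using p2 by (auto simp: h_def)
  hence "card (h ` ({..s} \<times> {..s})) \<le> p" using card_mono[of "{0..<int p}"] by force
  \<comment> \<open>Each index range includes 0, so there are \<open>(s + 1) ^ 2\<close> pairs for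
    only \<open>p\<close> residues.\<close>
  also have "p < card ({..s} \<times> {..s})" using s_gt by (simp add: power2_eq_square)
  finally have "\<not> inj_on h ({..s} \<times> {..s})" using pigeonhole by blast
  then obtain i j i' j' where ij: "i \<le> s" "j \<le> s" "i' \<le> s" "j' \<le> s" "(i, j) \<noteq> (i', j')"
    "h (i, j) = h (i', j')" unfolding inj_on_def by auto
  define x y where "x = int i - int i'" and "y = int j - int j'"
  have "int p dvd (int i - t * int j) - (int i' - t * int j')"
    using ij(6) unfolding h_def by (simp add: mod_eq_dvd_iff)
  hence dv: "int p dvd x - t * y" by (simp add: x_def y_def algebra_simps)
  have "int p dvd t\<^sup>2 + 1" using t by (simp add: cong_iff_dvd_diff)
  moreover have "x\<^sup>2 + y\<^sup>2 = (x - t * y) * (x + t * y) + y\<^sup>2 * (t\<^sup>2 + 1)"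
    by (simp add: algebra_simps power2_eq_square)
  ultimately have "int p dvd x\<^sup>2 + y\<^sup>2" using dv by simp
  then obtain c where c: "x\<^sup>2 + y\<^sup>2 = int p * c" by blast
  have "\<bar>x\<bar> \<le> int s" "\<bar>y\<bar> \<le> int s" using ij unfolding x_def y_def by linarith+
  hence "x\<^sup>2 \<le> (int s)\<^sup>2" "y\<^sup>2 \<le> (int s)\<^sup>2" by (simp_all add: abs_le_square_iff[symmetric])
  moreover have "(int s)\<^sup>2 < int p" using s_lt by (metis of_nat_less_iff of_nat_power)
  ultimately have "int p * c < int p * 2" using c by linarith
  hence "c < 2" using p2 by simp
  moreover have "0 < x\<^sup>2 + y\<^sup>2" using ij(5) by (auto simp: x_def y_def sum_power2_gt_zero_iff)
  hence "0 < c" using c p2 by (simp add: zero_less_mult_iff)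
  ultimately have "c = 1" by simp
  thus ?thesis using c by auto
qed

section \<open>Counting integer representations by Gaussian multiplication\<close>

text \<open>Signs, order and zero coordinates are all counted: these are the Gaussian integers of
  norm \<open>N\<close>, a family compatible with multiplication.\<close>

definition two_square_reps :: "nat \<Rightarrow> (int \<times> int) set" where
  "two_square_reps N = {(x, y). x\<^sup>2 + y\<^sup>2 = int N}"

lemma two_square_reps_subset: "two_square_reps N \<subseteq> {-int N..int N} \<times> {-int N..int N}"
proof (clarsimp simp: two_square_reps_def)
  fix x y :: int assume a: "x\<^sup>2 + y\<^sup>2 = int N"
  have "\<bar>z\<bar> \<le> z\<^sup>2" for z :: int
    using self_le_power[of "\<bar>z\<bar>" 2] by (cases "z = 0") auto
  from this[of x] this[of y] zero_le_power2[of x] zero_le_power2[of y] a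
  show "- int N \<le> x \<and> x \<le> int N \<and> - int N \<le> y \<and> y \<le> int N" by linarith
qed

lemma finite_two_square_reps: "finite (two_square_reps N)"
  by (rule finite_subset[OF two_square_reps_subset]) auto

text \<open>In terms of Gaussian integers, with \<open>\<pi> = a + b * \<i>\<close>: an element of norm \<open>p * M\<close> is a multiple
  of \<open>\<pi>\<close> or of its conjugate, and of both precisely when it is a multiple of \<open>p\<close>.\<close>

lemma card_two_square_reps_prime_mult:
  assumes p: "prime p" "odd p" and ab: "a\<^sup>2 + b\<^sup>2 = int p"
  shows "card (two_square_reps (p * M)) + (if p dvd M then card (two_square_reps (M div p)) else 0)
           = 2 * card (two_square_reps M)"
proof -
  \<comment> \<open>With \<open>(x, y)\<close> read as a Gaussian integer, \<open>f\<close>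
    multiplies by \<open>a + b * i\<close>, \<open>g\<close> by its conjugate, and \<open>h\<close>
    by their product \<open>p\<close>.\<close>
  define f where "f = (\<lambda>(x, y). (a * x - b * y, a * y + b * x))"
  define g where "g = (\<lambda>(x, y). (a * x + b * y, a * y - b * x))"
  define h where "h = (\<lambda>(x, y). (int p * x, int p * y))"
  let ?S = two_square_reps
  have fg: "f (g z) = h z" "g (f z) = h z" for z
    by (auto simp: f_def g_def h_def ab[symmetric] algebra_simps power2_eq_square split: prod.splits)
  have ip: "prime (int p)" and p0: "int p > 0" using p prime_gt_0_nat by auto
  have inj_h: "inj h" using p0 by (auto simp: h_def inj_on_def)
  have inj: "inj f" "inj g" using inj_h fg by (metis inj_on_def)+
  \<comment> \<open>Otherwise \<open>p\<close> would divide \<open>b\<close> as well, and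
    \<open>p ^ 2\<close> would divide \<open>p\<close>.\<close>
  have p_ndvd_a: "\<not> int p dvd a"
  proof
    assume d: "int p dvd a"
    hence "int p dvd b\<^sup>2" using ab by (metis dvd_add_right_iff dvd_mult dvd_refl power2_eq_square)
    hence "int p dvd b" using ip prime_dvd_power by blast
    hence "(int p)\<^sup>2 dvd int p" using d ab by (metis dvd_add dvd_power_same)
    thus False using ip by (metis not_prime_unit power2_eq_square dvd_times_left_cancel_iff mult.right_neutral not_prime_0)
  qed
  have fS: "f z \<in> ?S (p * M) \<longleftrightarrow> z \<in> ?S M" for z M
  proof -
    obtain x y where z: "z = (x, y)" by fastforce
    have "(a * x - b * y)\<^sup>2 + (a * y + b * x)\<^sup>2 = int p * (x\<^sup>2 + y\<^sup>2)"
      by (simp add: ab[symmetric] algebra_simps power2_eq_square)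
    thus ?thesis using p0 by (auto simp: z f_def two_square_reps_def)
  qed
  have gS: "g z \<in> ?S (p * M) \<longleftrightarrow> z \<in> ?S M" for z M
  proof -
    obtain x y where z: "z = (x, y)" by fastforce
    have "(a * x + b * y)\<^sup>2 + (a * y - b * x)\<^sup>2 = int p * (x\<^sup>2 + y\<^sup>2)"
      by (simp add: ab[symmetric] algebra_simps power2_eq_square)
    thus ?thesis using p0 by (auto simp: z g_def two_square_reps_def)
  qed
  have split: "z \<in> range f \<union> range g" if "z \<in> ?S (p * M)" for z
  proof -
    obtain x y where z: "z = (x, y)" by fastforce
    have xy: "x\<^sup>2 + y\<^sup>2 = int p * int M" using that by (simp add: z two_square_reps_def)
    \<comment> \<open>Both terms on the right are multiples of \<open>p\<close>, so \<open>p\<close>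
      divides the real part of \<open>g z\<close> or of \<open>f z\<close>.\<close>
    have "(a * x + b * y) * (a * x - b * y) = a\<^sup>2 * (x\<^sup>2 + y\<^sup>2) - y\<^sup>2 * (a\<^sup>2 + b\<^sup>2)"
      by (simp add: algebra_simps power2_eq_square)
    hence "int p dvd (a * x + b * y) * (a * x - b * y)" by (simp add: xy ab)
    hence "int p dvd a * x + b * y \<or> int p dvd a * x - b * y" using ip prime_dvd_mult_iff by blast
    thus ?thesis
    proof
      assume d: "int p dvd a * x + b * y"
      \<comment> \<open>As \<open>p\<close> does not divide \<open>a\<close>, the imaginary part of
        \<open>g z\<close> is a multiple of \<open>p\<close> too. Then
        \<open>g z = h w = g (f w)\<close>, and \<open>g\<close> can be cancelled.\<close>
      have "a * (a * y - b * x) = int p * y - b * (a * x + b * y)"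
        by (simp add: ab[symmetric] algebra_simps power2_eq_square)
      hence "int p dvd a * (a * y - b * x)" using d by simp
      hence "int p dvd a * y - b * x" using p_ndvd_a ip prime_dvd_mult_iff by blast
      then obtain w where "g z = h w" using d by (auto simp: z g_def h_def dvd_def)
      hence "z = f w" using inj fg by (metis inj_eq)
      thus ?thesis by auto
    next
      assume d: "int p dvd a * x - b * y"
      have "a * (a * y + b * x) = int p * y + b * (a * x - b * y)"
        by (simp add: ab[symmetric] algebra_simps power2_eq_square)
      hence "int p dvd a * (a * y + b * x)" using d by simp
      hence "int p dvd a * y + b * x" using p_ndvd_a ip prime_dvd_mult_iff by blast
      then obtain w where "f z = h w" using d by (auto simp: z f_def h_def dvd_def)
      hence "z = g w" using inj fg by (metis inj_eq)
      thus ?thesis by auto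
    qed
  qed
  have union: "?S (p * M) = f ` ?S M \<union> g ` ?S M" using split fS gS by blast
  \<comment> \<open>The real parts of \<open>g z\<close> and \<open>f z\<close> add up to
    \<open>2 * a * x\<close>, the imaginary parts to \<open>2 * a * y\<close>, and \<open>p\<close>
    divides neither 2 nor \<open>a\<close>.\<close>
  have both: "\<exists>w. z = h w" if "z = f w1" "z = g w2" for z w1 w2
  proof -
    obtain x y where z: "z = (x, y)" by fastforce
    have 1: "g z = h w1" "f z = h w2" using that(1) fg(2)[of w1] that(2) fg(1)[of w2] by simp_all
    have "int p dvd a * x + b * y" "int p dvd a * x - b * y"
      "int p dvd a * y - b * x" "int p dvd a * y + b * x"
      using 1 by (auto simp: z f_def g_def h_def split: prod.splits)
    hence "int p dvd (a * x + b * y) + (a * x - b * y)" "int p dvd (a * y - b * x) + (a * y + b * x)"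
      by (blast intro: dvd_add)+
    hence "int p dvd 2 * (a * x)" "int p dvd 2 * (a * y)" by simp_all
    moreover have "\<not> int p dvd 2" using p by (metis int_dvd_int_iff of_nat_numeral primes_dvd_imp_eq two_is_prime_nat even_numeral dvd_refl)
    ultimately have "int p dvd x" "int p dvd y" using p_ndvd_a ip prime_dvd_mult_iff by blast+
    thus ?thesis by (auto simp: z h_def dvd_def)
  qed
  \<comment> \<open>Cancelling \<open>p\<close> from an element divides its norm by
    \<open>p ^ 2\<close>, which takes \<open>p * M\<close> to \<open>M div p\<close>.\<close>
  have inter: "f ` ?S M \<inter> g ` ?S M = (if p dvd M then h ` ?S (M div p) else {})"
  proof (cases "p dvd M")
    case True
    then obtain K where K: "M = p * K" by blast
    have "z \<in> f ` ?S M \<inter> g ` ?S M \<longleftrightarrow> z \<in> h ` ?S K" for z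
    proof
      assume z: "z \<in> f ` ?S M \<inter> g ` ?S M"
      then obtain w where w: "z = h w" using both by blast
      have "z \<in> ?S (p * M)" using z fS by auto
      hence "w \<in> ?S K" using w fg gS fS K by metis
      thus "z \<in> h ` ?S K" using w by blast
    next
      assume "z \<in> h ` ?S K"
      then obtain w where w: "z = h w" "w \<in> ?S K" by blast
      hence "z = f (g w)" "z = g (f w)" "g w \<in> ?S M" "f w \<in> ?S M" using fg K fS gS by auto
      thus "z \<in> f ` ?S M \<inter> g ` ?S M" by blast
    qed
    hence "f ` ?S M \<inter> g ` ?S M = h ` ?S K" unfolding set_eq_iff by blast
    moreover have "M div p = K" using K p by (simp add: prime_gt_0_nat)
    ultimately show ?thesis using True by simp
  next
    case False
    have "z \<notin> f ` ?S M \<inter> g ` ?S M" for z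
    proof
      assume z: "z \<in> f ` ?S M \<inter> g ` ?S M"
      then obtain w where w: "z = h w" using both by blast
      have zS: "z \<in> ?S (p * M)" using z fS by auto
      obtain x y where xy: "w = (x, y)" by fastforce
      have "int p * (int p * (x\<^sup>2 + y\<^sup>2)) = int p * int M"
        using zS by (simp add: w xy h_def two_square_reps_def algebra_simps power2_eq_square)
      hence "int M = int p * (x\<^sup>2 + y\<^sup>2)" using p0 by simp
      hence "int p dvd int M" by simp
      thus False using False by simp
    qed
    thus ?thesis using False by auto
  qed
  have "card (?S (p * M)) + card (f ` ?S M \<inter> g ` ?S M) = card (f ` ?S M) + card (g ` ?S M)"
    unfolding union by (rule card_Un_Int[symmetric]) (auto simp: finite_two_square_reps)
  moreover have "card (f ` ?S M) = card (?S M)" "card (g ` ?S M) = card (?S M)"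
    using inj by (auto intro!: card_image intro: inj_on_subset)
  moreover have "card (h ` ?S (M div p)) = card (?S (M div p))"
    using inj_h by (auto intro!: card_image intro: inj_on_subset)
  ultimately show ?thesis by (auto simp: inter)
qed

text \<open>The recurrence makes the counts an arithmetic progression in \<open>j\<close>. As
  \<open>p\<close> does not divide \<open>M\<close>, the count doubles in the first step, so the
  common difference is the count for \<open>M\<close> itself.\<close>

lemma card_two_square_reps_prime_power_mult:
  assumes p: "prime p" "[p = 1] (mod 4)" and M: "\<not> p dvd M"
  shows "card (two_square_reps (p ^ j * M)) = (j + 1) * card (two_square_reps M)"
proof -
  have "odd p" using p(2) unfolding cong_def by presburger
  obtain a b where ab: "a\<^sup>2 + b\<^sup>2 = int p" using sum_two_squares_prime[OF p] by blast
  note rec = card_two_square_reps_prime_mult[OF p(1) \<open>odd p\<close> ab]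
  show ?thesis
  proof (induction j rule: less_induct)
    case (less j)
    consider "j = 0" | "j = 1" | i where "j = Suc (Suc i)" by (metis One_nat_def not0_implies_Suc)
    thus ?case
    proof cases
      case 2 thus ?thesis using rec[of M] M by simp
    next
      case (3 i)
      have "p ^ Suc i * M div p = p ^ i * M" using p by (simp add: prime_gt_0_nat)
      thus ?thesis using rec[of "p ^ Suc i * M"] less.IH[of i] less.IH[of "Suc i"] 3
        by (simp add: algebra_simps)
    qed simp
  qed
qed

lemma card_two_square_reps_1: "card (two_square_reps 1) = 4"
proof -
  have "{-1..1} = {-1, 0, 1 :: int}" by auto
  hence "two_square_reps 1 = {(1,0),(-1,0),(0,1),(0,-1)}"
    using two_square_reps_subset[of 1] by (auto simp: two_square_reps_def)
  thus ?thesis by simp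
qed

lemma card_two_square_reps_2: "card (two_square_reps 2) = 4"
proof -
  have "{-2..2} = {-2, -1, 0, 1, 2 :: int}" by auto
  hence "two_square_reps 2 = {(1,1),(-1,1),(1,-1),(-1,-1)}"
    using two_square_reps_subset[of 2] by (auto simp: two_square_reps_def)
  thus ?thesis by simp
qed

section \<open>Positive representations of the two families of numbers\<close>

text \<open>These pairs index the product sines that belong to the eigenvalue
  \<open>N\<close>.\<close>

definition pos_reps :: "nat \<Rightarrow> (nat \<times> nat) set" where
  "pos_reps N = {(n, m). 0 < n \<and> 0 < m \<and> n\<^sup>2 + m\<^sup>2 = N}"

text \<open>When \<open>N\<close> is not a square no coordinate can vanish. The four choices of
  signs then act freely, and each orbit contains exactly one positive pair.\<close>

lemma card_two_square_reps_nonsquare: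
  assumes nsq: "\<And>y. y\<^sup>2 \<noteq> N"
  shows "card (two_square_reps N) = 4 * card (pos_reps N)"
proof -
  have nz: "x \<noteq> 0 \<and> y \<noteq> 0" if "(x, y) \<in> two_square_reps N" for x y
  proof -
    have "int ((nat \<bar>z\<bar>)\<^sup>2) = z\<^sup>2" for z by simp
    hence "z\<^sup>2 \<noteq> int N" for z :: int using nsq by (metis of_nat_eq_iff)
    thus ?thesis using that by (auto simp: two_square_reps_def)
  qed
  let ?f = "\<lambda>((e, e'), (n, m)). (e * int n, e' * int m)"
  let ?g = "\<lambda>(x, y). ((sgn x, sgn y), (nat \<bar>x\<bar>, nat \<bar>y\<bar>))"
  have "bij_betw ?f (({1,-1} \<times> {1,-1}) \<times> pos_reps N) (two_square_reps N)"
  proof (rule bij_betw_byWitness[where f' = ?g])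
    show "\<forall>z\<in>({1,-1} \<times> {1,-1}) \<times> pos_reps N. ?g (?f z) = z"
      by (auto simp: pos_reps_def sgn_mult)
    show "\<forall>z\<in>two_square_reps N. ?f (?g z) = z" by (auto simp: sgn_mult_abs)
    show "?f ` (({1,-1} \<times> {1,-1}) \<times> pos_reps N) \<subseteq> two_square_reps N"
      by (auto simp: pos_reps_def two_square_reps_def)
    show "?g ` two_square_reps N \<subseteq> ({1,-1} \<times> {1,-1}) \<times> pos_reps N"
    proof
      fix z assume "z \<in> ?g ` two_square_reps N"
      then obtain x y where z: "z = ?g (x, y)" and xy: "(x, y) \<in> two_square_reps N" by auto
      have "int ((nat \<bar>x\<bar>)\<^sup>2 + (nat \<bar>y\<bar>)\<^sup>2) = int N" using xy by (simp add: two_square_reps_def)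
      hence "(nat \<bar>x\<bar>)\<^sup>2 + (nat \<bar>y\<bar>)\<^sup>2 = N" by (simp only: of_nat_eq_iff)
      thus "z \<in> ({1,-1} \<times> {1,-1}) \<times> pos_reps N"
        using nz[OF xy] z by (auto simp: pos_reps_def sgn_if)
    qed
  qed
  hence "card (two_square_reps N) = card ((({1,-1::int} \<times> {1,-1::int})) \<times> pos_reps N)"
    by (metis bij_betw_same_card)
  thus ?thesis by (simp add: card_cartesian_product)
qed

text \<open>The exponent of \<open>q\<close> in \<open>q * m\<close> is 1, whereas in a square it
  would be even.\<close>

lemma prime_mult_nonsquare:
  fixes q m y :: nat
  assumes "prime q" "\<not> q dvd m"
  shows "y\<^sup>2 \<noteq> q * m"
proof
  assume a: "y\<^sup>2 = q * m"
  hence "q dvd y" using assms prime_dvd_power by (metis dvd_triv_left)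
  then obtain z where "y = q * z" by blast
  hence "q * (q * z\<^sup>2) = q * m" using a by (simp add: power2_eq_square algebra_simps)
  hence "m = q * z\<^sup>2" using assms by (simp add: prime_gt_0_nat)
  thus False using assms by simp
qed

text \<open>The count of all representations is 4 at 1, doubles at \<open>p1\<close>, and gains the
  factor \<open>k\<close> from the exponent \<open>k - 1\<close> of \<open>p2\<close>. Since
  \<open>p1\<close> occurs exactly once, the number is not a square and a quarter of
  \<open>8 * k\<close> remains.\<close>

lemma card_pos_reps_even:
  assumes "prime p1" "prime p2" "p1 \<noteq> p2" "[p1 = 1] (mod 4)" "[p2 = 1] (mod 4)" "k \<ge> 1"
  shows "card (pos_reps (p1 * p2 ^ (k - 1))) = 2 * k"
proof -
  have 1: "\<not> p1 dvd p2 ^ (k - 1)" "\<not> p2 dvd p1"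
    using assms by (metis prime_dvd_power primes_dvd_imp_eq)+
  have "\<not> p1 dvd 1" using assms by (simp add: prime_nat_iff)
  hence "card (two_square_reps p1) = 8"
    using card_two_square_reps_prime_power_mult[of p1 1 1] card_two_square_reps_1 assms by simp
  hence "card (two_square_reps (p1 * p2 ^ (k - 1))) = 8 * k"
    using card_two_square_reps_prime_power_mult[of p2 p1 "k - 1"] 1 assms by (simp add: mult.commute)
  thus ?thesis using card_two_square_reps_nonsquare[OF prime_mult_nonsquare[OF assms(1) 1(1)]] by simp
qed

text \<open>The four representations of 2 gain the factor \<open>2 * k + 1\<close>; the single
  factor 2 keeps the number from being a square.\<close>

lemma card_pos_reps_odd:
  assumes "prime p" "[p = 1] (mod 4)"
  shows "card (pos_reps (2 * p ^ (2 * k))) = 2 * k + 1"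
proof -
  have odd: "odd p" using assms(2) unfolding cong_def by presburger
  hence "\<not> p dvd 2" using assms by (metis primes_dvd_imp_eq two_is_prime_nat even_numeral dvd_refl)
  hence "card (two_square_reps (2 * p ^ (2 * k))) = (2 * k + 1) * 4"
    using card_two_square_reps_prime_power_mult[of p 2 "2 * k"] card_two_square_reps_2 assms by (simp add: mult.commute)
  moreover have "\<not> 2 dvd p ^ (2 * k)" using odd by simp
  ultimately show ?thesis using card_two_square_reps_nonsquare[OF prime_mult_nonsquare[OF two_is_prime_nat]] by simp
qed

section \<open>Double sine coefficients of solutions\<close>

text \<open>Since \<open>sin x * cos x ^ k\<close> is a combination of functions \<open>sin (n * x)\<close>, the product
  \<open>f x * sin x\<close> is orthogonal to \<open>sin x * P (cos x)\<close> for every polynomial \<open>P\<close>; by Weierstrass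
  some \<open>P (cos x)\<close> is uniformly close to \<open>f x * sin x\<close>.\<close>

lemma sine_complete:
  fixes f :: "real \<Rightarrow> real"
  assumes cont: "continuous_on {0..pi} f"
    and orth: "\<And>n::nat. 0 < n \<Longrightarrow> integral {0..pi} (\<lambda>x. f x * sin (real n * x)) = 0"
    and x: "x \<in> {0..pi}"
  shows "f x = 0"
proof -
  have int[simp]: "(\<lambda>x. f x * g x) integrable_on {0..pi}" if "continuous_on {0..pi} g" for g :: "real \<Rightarrow> real"
    using cont that by (intro integrable_continuous_real continuous_intros)
  \<comment> \<open>The product-to-sum formula trades one cosine for the frequencies
    \<open>n + 1\<close> and \<open>n - 1\<close>. The frequency 0 is included, with a vanishing
    sine, so that \<open>n - 1\<close> is always covered.\<close>
  have pow: "integral {0..pi} (\<lambda>x. f x * (sin (real n * x) * cos x ^ k)) = 0" for n k :: nat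
  proof (induction k arbitrary: n)
    case 0 thus ?case using orth[of n] by (cases "n = 0") auto
  next
    case (Suc k)
    show ?case
    proof (cases n)
      case (Suc l)
      have e: "f x * (sin (real n * x) * cos x ^ Suc k) =
        (f x * (sin (real (n + 1) * x) * cos x ^ k) + f x * (sin (real l * x) * cos x ^ k)) / 2" for x
      proof -
        have "sin (real (n + 1) * x) + sin (real l * x) = 2 * (sin (real n * x) * cos x)"
          using sin_times_cos[of "real n * x" x] Suc by (simp add: algebra_simps)
        thus ?thesis by (simp add: algebra_simps) (simp add: algebra_simps flip: distrib_left)
      qed
      show ?thesis unfolding e
        by (subst integral_divide, subst integral_add) (simp_all only: Suc.IH int continuous_intros, simp)
    qed simp
  qed
  have poly: "integral {0..pi} (\<lambda>x. f x * (sin x * P (cos x))) = 0" if P: "real_polynomial_function P" for P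
  proof -
    obtain a n where a: "P = (\<lambda>x. \<Sum>i\<le>n. a i * x ^ i)" using P real_polynomial_function_imp_sum by blast
    have e: "f x * (sin x * P (cos x)) = (\<Sum>i\<le>n. a i * (f x * (sin (real 1 * x) * cos x ^ i)))" for x
      by (simp add: a sum_distrib_left algebra_simps)
    have i1: "(\<lambda>x. a i * (f x * (sin (real 1 * x) * cos x ^ i))) integrable_on {0..pi}" for i
      by (intro integrable_continuous_real continuous_intros cont)
    show ?thesis unfolding e
      by (subst integral_sum) (use i1 in \<open>simp_all only: finite_atMost integral_mult_right pow\<close>, simp)
  qed
  \<comment> \<open>\<open>J\<close> is the squared L2 norm of \<open>f x * sin x\<close>; it has to
    vanish.\<close>
  define J where "J = integral {0..pi} (\<lambda>x. f x * sin x * (f x * sin x))"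
  have cs: "continuous_on {0..pi} (\<lambda>x. f x * sin x)" using cont by (intro continuous_intros)
  have "bounded ((\<lambda>x. f x * sin x) ` {0..pi})"
    by (intro compact_imp_bounded compact_continuous_image cs compact_Icc)
  then obtain B where B: "0 < B" "\<And>x. x \<in> {0..pi} \<Longrightarrow> \<bar>f x * sin x\<bar> \<le> B"
    unfolding bounded_pos real_norm_def by blast
  have J: "J = 0"
  proof (rule ccontr)
    assume "J \<noteq> 0"
    \<comment> \<open>Chosen so that the bound \<open>B * e * pi\<close> reached below is half of
      the absolute value of \<open>J\<close>.\<close>
    define e where "e = \<bar>J\<bar> / (2 * (B * pi))"
    have e0: "0 < e" using \<open>J \<noteq> 0\<close> B by (simp add: e_def)
    \<comment> \<open>The substitution \<open>t = cos x\<close> moves the problem to the interval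
      where Weierstrass approximation by polynomials in \<open>t\<close> applies.\<close>
    have "continuous_on {-1..1} (\<lambda>t. f (arccos t) * sin (arccos t))"
      by (intro continuous_intros continuous_on_compose2[OF cont]) (auto intro: arccos_lbound arccos_ubound)
    then obtain P where P: "real_polynomial_function P"
      "\<And>t. t \<in> {-1..1} \<Longrightarrow> \<bar>f (arccos t) * sin (arccos t) - P t\<bar> < e"
      by (rule Stone_Weierstrass_real_polynomial_function[OF compact_Icc _ e0]) blast
    have close: "\<bar>f x * sin x - P (cos x)\<bar> \<le> e" if "x \<in> {0..pi}" for x
      using P(2)[of "cos x"] that by (simp add: arccos_cos)
    have cP: "continuous_on {0..pi} (\<lambda>x. P (cos x))"
    proof -
      have "continuous_on UNIV P"
        using P(1) by (simp add: real_polynomial_function_eq continuous_on_polymonial_function)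
      thus ?thesis by (rule continuous_on_compose2) (auto intro: continuous_intros)
    qed
    have "J = integral {0..pi} (\<lambda>x. f x * (sin x * (f x * sin x))) - integral {0..pi} (\<lambda>x. f x * (sin x * P (cos x)))"
      using poly[OF P(1)] by (simp add: J_def algebra_simps)
    also have "\<dots> = integral {0..pi} (\<lambda>x. f x * sin x * (f x * sin x - P (cos x)))"
      using cs cP by (subst integral_diff[symmetric])
        (auto simp: right_diff_distrib mult.assoc intro!: continuous_intros int cont)
    also have "norm \<dots> \<le> (B * e) * (pi - 0)"
    proof (rule integral_bound)
      show "continuous_on {0..pi} (\<lambda>x. f x * sin x * (f x * sin x - P (cos x)))"
        using cP by (intro continuous_intros cont)
      fix t assume t: "t \<in> {0..pi}"
      have "\<bar>f t * sin t\<bar> * \<bar>f t * sin t - P (cos t)\<bar> \<le> B * e"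
        by (intro mult_mono B(2) close t) (use B(1) in simp_all)
      thus "norm (f t * sin t * (f t * sin t - P (cos t))) \<le> B * e"
        by (simp only: real_norm_def abs_mult)
    qed simp
    also have "\<dots> = \<bar>J\<bar> / 2" using B by (simp add: e_def field_simps)
    finally show False using \<open>J \<noteq> 0\<close> by simp
  qed
  have z: "f y * sin y * (f y * sin y) = 0" if "y \<in> {0..pi}" for y
    using integral_eq_0_iff[of 0 pi "\<lambda>x. f x * sin x * (f x * sin x)"] J that
      continuous_on_mult[OF cs cs]
    by (auto simp: J_def)
  have "f y = 0" if "y \<in> {0<..<pi}" for y
    using z[of y] that sin_gt_zero[of y] by auto
  \<comment> \<open>At the endpoints the sine vanishes and cannot be cancelled, so continuity
    extends the result to them.\<close>
  thus ?thesis
    using continuous_constant_on_closure[of "{0<..<pi}" f 0 x] cont x by (simp add: closure_greaterThanLessThan)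
qed

section \<open>Double sine coefficients on the closed square\<close>

text \<open>An unnormalised Fourier coefficient, written as an iterated integral so that
  one-variable results apply to each integration.\<close>

definition sine_coeff :: "nat \<Rightarrow> nat \<Rightarrow> (real \<times> real \<Rightarrow> real) \<Rightarrow> real" where
  "sine_coeff n m u =
     integral {0..pi} (\<lambda>y. integral {0..pi} (\<lambda>x. u (x, y) * sin (real n * x)) * sin (real m * y))"

abbreviation closed_square :: "(real \<times> real) set" where
  "closed_square \<equiv> {0..pi} \<times> {0..pi}"

lemma closure_square_domain: "closure square_domain = closed_square"
  by (simp add: square_domain_def closure_Times closure_greaterThanLessThan)

lemma open_square_domain: "open square_domain"
  by (simp add: square_domain_def open_Times)

lemma frontier_square_domain: "frontier square_domain = closed_square - square_domain"
  using open_square_domain by (simp add: frontier_def closure_square_domain interior_open)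

lemma continuous_on_integral_param:
  fixes f :: "'a::topological_space \<Rightarrow> real \<Rightarrow> real"
  assumes "continuous_on (U \<times> {a..b}) (\<lambda>(x, t). f x t)"
  shows "continuous_on U (\<lambda>x. integral {a..b} (f x))"
  using integral_continuous_on_param[of U a b f] assms by simp

lemma continuous_on_slice:
  assumes "continuous_on (A \<times> B) u" "y \<in> B"
  shows "continuous_on A (\<lambda>x. u (x, y))"
  by (rule continuous_on_compose2[OF assms(1)]) (use assms(2) in \<open>auto intro!: continuous_intros\<close>)

lemma continuous_on_swap_args:
  assumes "continuous_on (A \<times> B) u"
  shows "continuous_on (B \<times> A) (\<lambda>(x, y). u (y, x))"
  unfolding case_prod_unfold
  by (rule continuous_on_compose2[OF assms]) (auto intro!: continuous_intros)

lemma continuous_on_inner_sine: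
  assumes "continuous_on closed_square u"
  shows "continuous_on {0..pi} (\<lambda>y. integral {0..pi} (\<lambda>x. u (x, y) * sin (real n * x)))"
proof (rule continuous_on_integral_param)
  show "continuous_on closed_square (\<lambda>(y, x). u (x, y) * sin (real n * x))"
    using continuous_on_swap_args[OF assms] by (auto simp: case_prod_unfold intro!: continuous_intros)
qed

lemma sine_coeff_cong:
  assumes "\<And>z. z \<in> closed_square \<Longrightarrow> u z = v z"
  shows "sine_coeff n m u = sine_coeff n m v"
  unfolding sine_coeff_def
  by (intro integral_cong arg_cong2[where f = "(*)"] refl) (use assms in auto)

lemma sine_coeff_zero [simp]: "sine_coeff n m (\<lambda>z. 0) = 0"
  by (simp add: sine_coeff_def)

lemma sine_coeff_cmult [simp]: "sine_coeff n m (\<lambda>z. c * u z) = c * sine_coeff n m u"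
  by (simp add: sine_coeff_def mult.assoc)

lemma sine_coeff_add:
  assumes u: "continuous_on closed_square u" and v: "continuous_on closed_square v"
  shows "sine_coeff n m (\<lambda>z. u z + v z) = sine_coeff n m u + sine_coeff n m v"
proof -
  have int: "(\<lambda>x. w (x, y) * sin (real n * x)) integrable_on {0..pi}"
    if "continuous_on closed_square w" "y \<in> {0..pi}" for w y
    using continuous_on_slice[OF that] by (intro integrable_continuous_real continuous_intros)
  have int2: "(\<lambda>y. integral {0..pi} (\<lambda>x. w (x, y) * sin (real n * x)) * sin (real m * y)) integrable_on {0..pi}"
    if "continuous_on closed_square w" for w
    using continuous_on_inner_sine[OF that] by (intro integrable_continuous_real continuous_intros)
  have "sine_coeff n m (\<lambda>z. u z + v z) = integral {0..pi} (\<lambda>y.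
      integral {0..pi} (\<lambda>x. u (x, y) * sin (real n * x)) * sin (real m * y) +
      integral {0..pi} (\<lambda>x. v (x, y) * sin (real n * x)) * sin (real m * y))"
    unfolding sine_coeff_def
    by (intro integral_cong) (simp add: distrib_right integral_add int u v)
  also have "\<dots> = sine_coeff n m u + sine_coeff n m v"
    unfolding sine_coeff_def by (intro integral_add int2 u v)
  finally show ?thesis .
qed

lemma sine_coeff_sum:
  assumes "finite A" "\<And>a. a \<in> A \<Longrightarrow> continuous_on closed_square (u a)"
  shows "sine_coeff n m (\<lambda>z. \<Sum>a\<in>A. u a z) = (\<Sum>a\<in>A. sine_coeff n m (u a))"
  using assms by (induction rule: finite_induct) (simp_all add: sine_coeff_add continuous_on_sum)

text \<open>Fubini's theorem for a continuous integrand. It transfers what is proved for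
  \<open>x\<close>-derivatives to \<open>y\<close>-derivatives.\<close>

lemma sine_coeff_swap:
  assumes "continuous_on closed_square u"
  shows "sine_coeff n m (\<lambda>(x, y). u (y, x)) = sine_coeff m n u"
proof -
  have "continuous_on (cbox (0, 0) (pi, pi)) (\<lambda>(y, x). u (y, x) * sin (real m * y) * sin (real n * x))"
    using assms by (auto simp: case_prod_unfold cbox_Pair_eq intro!: continuous_intros)
  from integral_swap_continuous[OF this] show ?thesis
    by (simp add: sine_coeff_def mult.assoc mult.left_commute mult.commute flip: integral_mult_right integral_mult_left)
qed

text \<open>One-variable completeness is used twice: in \<open>y\<close> it makes every inner
  integral vanish, and then in \<open>x\<close>, for fixed \<open>y\<close>, the function
  itself.\<close>

lemma sine_coeff_complete:
  assumes u: "continuous_on closed_square u"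
    and orth: "\<And>n m. 0 < n \<Longrightarrow> 0 < m \<Longrightarrow> sine_coeff n m u = 0"
    and z: "z \<in> closed_square"
  shows "u z = 0"
proof -
  obtain x y where xy: "z = (x, y)" "x \<in> {0..pi}" "y \<in> {0..pi}" using z by auto
  have "integral {0..pi} (\<lambda>x. u (x, y) * sin (real n * x)) = 0" if "0 < n" for n
    using sine_complete[OF continuous_on_inner_sine[OF u, of n] _ xy(3)] orth[OF that] by (simp add: sine_coeff_def)
  thus ?thesis using sine_complete[OF continuous_on_slice[OF u xy(3)] _ xy(2)] xy(1) by simp
qed

text \<open>The derivatives of a solution need not extend to the boundary, so the integrations by parts
  are carried out for the solution contracted towards the centre of the square by a factor
  \<open>r < 1\<close>. Both sides of the resulting identity are continuous in \<open>r \<in> {0..1}\<close>.\<close>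

definition dilate :: "real \<Rightarrow> real \<Rightarrow> real" where
  "dilate r x = pi / 2 + r * (x - pi / 2)"

lemma dilate_1 [simp]: "dilate 1 x = x"
  by (simp add: dilate_def)

lemma dilate_mem:
  assumes "0 \<le> r" "r \<le> 1" "x \<in> {0..pi}"
  shows "dilate r x \<in> {0..pi}"
proof -
  have "\<bar>x - pi / 2\<bar> \<le> pi / 2" using assms by (auto simp: abs_if field_simps)
  hence "\<bar>r * (x - pi / 2)\<bar> \<le> 1 * (pi / 2)" unfolding abs_mult using assms by (intro mult_mono) auto
  thus ?thesis by (auto simp: dilate_def)
qed

text \<open>A strict contraction moves even the endpoints into the open interval, where the
  derivatives of a solution are available.\<close>

lemma dilate_mem_open:
  assumes "0 < r" "r < 1" "x \<in> {0..pi}"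
  shows "dilate r x \<in> {0<..<pi}"
proof -
  have "\<bar>x - pi / 2\<bar> \<le> pi / 2" using assms by (auto simp: abs_if field_simps)
  hence "\<bar>r * (x - pi / 2)\<bar> \<le> r * (pi / 2)" unfolding abs_mult using assms by (intro mult_mono) auto
  also have "\<dots> < 1 * (pi / 2)" using assms by (intro mult_strict_right_mono) auto
  finally show ?thesis by (auto simp: dilate_def)
qed

lemma continuous_on_dilate [continuous_intros]:
  "continuous_on S f \<Longrightarrow> continuous_on S g \<Longrightarrow> continuous_on S (\<lambda>z. dilate (f z) (g z))"
  unfolding dilate_def by (intro continuous_intros)

section \<open>Integration by parts on contracted squares\<close>

text \<open>Two integrations by parts at once: \<open>?G\<close> is an antiderivative of the
  combined integrand, and its \<open>f1\<close> term vanishes at 0 and \<open>pi\<close> along with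
  the sine. The factor \<open>r ^ 2\<close> comes from the chain rule.\<close>

lemma sine_integral_second_derivative:
  assumes r: "0 < r" "r < 1"
    and f: "\<And>x. x \<in> {0<..<pi} \<Longrightarrow> (f has_real_derivative f1 x) (at x)"
    and f1: "\<And>x. x \<in> {0<..<pi} \<Longrightarrow> (f1 has_real_derivative f2 x) (at x)"
    and f2: "continuous_on {0<..<pi} f2"
  shows "integral {0..pi} (\<lambda>x. r\<^sup>2 * f2 (dilate r x) * sin (real n * x)) =
    - (real n)\<^sup>2 * integral {0..pi} (\<lambda>x. f (dilate r x) * sin (real n * x))
    + real n * (f (dilate r 0) - cos (real n * pi) * f (dilate r pi))"
proof -
  let ?G = "\<lambda>x. r * f1 (dilate r x) * sin (real n * x) - real n * (f (dilate r x) * cos (real n * x))"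
  let ?a = "\<lambda>x. r\<^sup>2 * f2 (dilate r x) * sin (real n * x)"
  let ?b = "\<lambda>x. f (dilate r x) * sin (real n * x)"
  have cf: "continuous_on {0<..<pi} f"
    using f by (meson DERIV_isCont continuous_at_imp_continuous_on)
  have cd: "continuous_on {0..pi} (dilate r)" by (intro continuous_intros)
  have sub: "dilate r ` {0..pi} \<subseteq> {0<..<pi}" using dilate_mem_open r by blast
  have ia: "?a integrable_on {0..pi}" and ib: "?b integrable_on {0..pi}"
    by (intro integrable_continuous_real continuous_intros continuous_on_compose2[OF f2 cd sub]
         continuous_on_compose2[OF cf cd sub])+
  have "((\<lambda>x. ?a x + (real n)\<^sup>2 * ?b x) has_integral ?G pi - ?G 0) {0..pi}"
  proof (rule fundamental_theorem_of_calculus)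
    fix x assume x: "x \<in> {0..pi}"
    have dx: "dilate r x \<in> {0<..<pi}" using dilate_mem_open r x by blast
    have dd: "(dilate r has_real_derivative r) (at x)"
      unfolding dilate_def by (auto intro!: derivative_eq_intros)
    note [derivative_intros] = DERIV_chain2[OF f[OF dx] dd] DERIV_chain2[OF f1[OF dx] dd]
    have "(?G has_real_derivative ?a x + (real n)\<^sup>2 * ?b x) (at x)"
      by (auto intro!: derivative_eq_intros simp: algebra_simps power2_eq_square)
    thus "(?G has_vector_derivative ?a x + (real n)\<^sup>2 * ?b x) (at x within {0..pi})"
      by (simp add: has_real_derivative_iff_has_vector_derivative has_vector_derivative_at_within)
  qed simp
  hence "integral {0..pi} (\<lambda>x. ?a x + (real n)\<^sup>2 * ?b x) = ?G pi - ?G 0" by (rule integral_unique)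
  moreover have "integral {0..pi} (\<lambda>x. ?a x + (real n)\<^sup>2 * ?b x)
      = integral {0..pi} ?a + (real n)\<^sup>2 * integral {0..pi} ?b"
    using ia ib by (subst integral_add) (auto intro: integrable_on_mult_right)
  ultimately show ?thesis by (simp add: algebra_simps)
qed

text \<open>The contribution of the two vertical sides of the contracted square to the integration
  by parts, up to the factor \<open>n\<close>; \<open>cos (real n * pi)\<close> is the sign
  \<open>(-1) ^ n\<close>.\<close>

definition edge_coeff :: "nat \<Rightarrow> nat \<Rightarrow> real \<Rightarrow> (real \<times> real \<Rightarrow> real) \<Rightarrow> real" where
  "edge_coeff n m r u = integral {0..pi} (\<lambda>y.
     (u (dilate r 0, dilate r y) - cos (real n * pi) * u (dilate r pi, dilate r y)) * sin (real m * y))"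

definition dilate_pair :: "real \<Rightarrow> real \<times> real \<Rightarrow> real \<times> real" where
  "dilate_pair r = (\<lambda>(x, y). (dilate r x, dilate r y))"

lemma continuous_on_dilate_pair:
  assumes "0 < r" "r < 1" "continuous_on square_domain u"
  shows "continuous_on closed_square (\<lambda>z. u (dilate_pair r z))"
  by (rule continuous_on_compose2[OF assms(3)])
    (use assms dilate_mem_open in \<open>auto simp: dilate_pair_def case_prod_unfold square_domain_def intro!: continuous_intros\<close>)

text \<open>The one-variable identity holds on each horizontal line and is then integrated against
  \<open>sin (real m * y)\<close>.\<close>

lemma sine_coeff_second_derivative:
  assumes r: "0 < r" "r < 1"
    and d1: "\<And>x y. (x, y) \<in> square_domain \<Longrightarrow> ((\<lambda>t. u (t, y)) has_real_derivative u1 (x, y)) (at x)"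
    and d2: "\<And>x y. (x, y) \<in> square_domain \<Longrightarrow> ((\<lambda>t. u1 (t, y)) has_real_derivative u2 (x, y)) (at x)"
    and u: "continuous_on square_domain u" and u2: "continuous_on square_domain u2"
  shows "r\<^sup>2 * sine_coeff n m (\<lambda>z. u2 (dilate_pair r z)) =
    - (real n)\<^sup>2 * sine_coeff n m (\<lambda>z. u (dilate_pair r z)) + real n * edge_coeff n m r u"
proof -
  let ?i = "\<lambda>w y. integral {0..pi} (\<lambda>x. w (dilate r x, dilate r y) * sin (real n * x))"
  let ?e = "\<lambda>y. u (dilate r 0, dilate r y) - cos (real n * pi) * u (dilate r pi, dilate r y)"
  note cu = continuous_on_dilate_pair[OF r u]
  have inner: "r\<^sup>2 * ?i u2 y = - (real n)\<^sup>2 * ?i u y + real n * ?e y" if y: "y \<in> {0..pi}" for y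
  proof -
    have dy: "dilate r y \<in> {0<..<pi}" using dilate_mem_open r y by blast
    have "integral {0..pi} (\<lambda>x. r\<^sup>2 * u2 (dilate r x, dilate r y) * sin (real n * x)) =
       - (real n)\<^sup>2 * ?i u y + real n * ?e y"
    proof (rule sine_integral_second_derivative[OF r, of "\<lambda>x. u (x, dilate r y)" "\<lambda>x. u1 (x, dilate r y)"
            "\<lambda>x. u2 (x, dilate r y)"])
      show "continuous_on {0<..<pi} (\<lambda>x. u2 (x, dilate r y))"
        using continuous_on_slice[OF u2[unfolded square_domain_def] dy] .
    qed (use d1 d2 dy in \<open>auto simp: square_domain_def\<close>)
    thus ?thesis by (simp add: mult.assoc)
  qed
  have "r\<^sup>2 * sine_coeff n m (\<lambda>z. u2 (dilate_pair r z)) =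
      integral {0..pi} (\<lambda>y. r\<^sup>2 * ?i u2 y * sin (real m * y))"
    by (simp add: sine_coeff_def dilate_pair_def mult.assoc)
  also have "\<dots> = integral {0..pi} (\<lambda>y. - (real n)\<^sup>2 * (?i u y * sin (real m * y)) + real n * (?e y * sin (real m * y)))"
    by (intro integral_cong) (simp only: inner, simp add: algebra_simps)
  also have "\<dots> = integral {0..pi} (\<lambda>y. - (real n)\<^sup>2 * (?i u y * sin (real m * y)))
      + integral {0..pi} (\<lambda>y. real n * (?e y * sin (real m * y)))"
  proof (intro integral_add integrable_continuous_real continuous_intros)
    show "continuous_on {0..pi} (?i u)"
      using continuous_on_inner_sine[OF cu, of n] by (simp add: dilate_pair_def)
    have "continuous_on {0..pi} (\<lambda>y. u (dilate r a, dilate r y))" if "a \<in> {0..pi}" for a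
      using continuous_on_slice[OF continuous_on_swap_args[OF cu] that] by (simp add: dilate_pair_def)
    from this[of 0] this[of pi] show "continuous_on {0..pi} (\<lambda>y. u (dilate r 0, dilate r y))"
      "continuous_on {0..pi} (\<lambda>y. u (dilate r pi, dilate r y))" by simp_all
  qed
  also have "\<dots> = - (real n)\<^sup>2 * sine_coeff n m (\<lambda>z. u (dilate_pair r z)) + real n * edge_coeff n m r u"
    by (simp add: sine_coeff_def edge_coeff_def dilate_pair_def)
  finally show ?thesis .
qed

text \<open>Makes the passage to \<open>r = 1\<close> possible from continuity of \<open>u\<close>
  alone. Continuity of parameter integrals is used twice, first with the pair of \<open>r\<close>
  and \<open>y\<close> as parameter.\<close>

lemma continuous_on_sine_coeff_dilate:
  assumes u: "continuous_on closed_square u"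
  shows "continuous_on {0..1} (\<lambda>r. sine_coeff n m (\<lambda>z. u (dilate_pair r z)))"
proof -
  have "continuous_on (({0..1} \<times> {0..pi}) \<times> {0..pi}) (\<lambda>(p, x). u (dilate (fst p) x, dilate (fst p) (snd p)) * sin (real n * x))"
    unfolding case_prod_unfold
    by (intro continuous_intros continuous_on_compose2[OF u]) (use dilate_mem in auto)
  from continuous_on_integral_param[OF this]
  have "continuous_on ({0..1} \<times> {0..pi}) (\<lambda>(r, y). integral {0..pi} (\<lambda>x. u (dilate r x, dilate r y) * sin (real n * x)) * sin (real m * y))"
    unfolding case_prod_unfold by (intro continuous_intros)
  from continuous_on_integral_param[OF this] show ?thesis
    by (simp add: sine_coeff_def dilate_pair_def)
qed

lemma continuous_on_edge_coeff:
  assumes u: "continuous_on closed_square u"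
  shows "continuous_on {0..1} (\<lambda>r. edge_coeff n m r u)"
  unfolding edge_coeff_def
proof (rule continuous_on_integral_param)
  show "continuous_on ({0..1} \<times> {0..pi}) (\<lambda>(r, y). (u (dilate r 0, dilate r y) -
     cos (real n * pi) * u (dilate r pi, dilate r y)) * sin (real m * y))"
    unfolding case_prod_unfold
    by (intro continuous_intros continuous_on_compose2[OF u]) (use dilate_mem in auto)
qed

text \<open>Pairing the equation on a contracted square with the product of sines leaves only side
  terms. These disappear at \<open>r = 1\<close> by the boundary condition.\<close>

lemma sine_coeff_dirichlet_solution:
  assumes sol: "dirichlet_solution l u"
  shows "(l - (real n)\<^sup>2 - (real m)\<^sup>2) * sine_coeff n m u = 0"
proof -
  let ?D = square_domain
  let ?s = "\<lambda>w z :: real \<times> real. w (snd z, fst z)"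
  have c: "continuous_on closed_square u" and C2: "C2_on ?D u"
    and pde: "\<And>z. z \<in> ?D \<Longrightarrow> laplacian u z + l * u z = 0"
    and bd: "\<And>z. z \<in> closed_square - ?D \<Longrightarrow> u z = 0"
    using sol by (auto simp: dirichlet_solution_def closure_square_domain frontier_square_domain)
  have sub: "?D \<subseteq> closed_square" by (auto simp: square_domain_def)
  have cD: "continuous_on ?D u" using c sub continuous_on_subset by blast
  have cxx: "continuous_on ?D (partial_x (partial_x u))" and cyy: "continuous_on ?D (partial_y (partial_y u))"
    using C2 by (auto simp: C2_on_def C1_on_def)
  have dx: "((\<lambda>t. w (t, y)) has_real_derivative partial_x w (x, y)) (at x)"
    and dy: "((\<lambda>t. w (x, t)) has_real_derivative partial_y w (x, y)) (at y)"
    if "C1_on ?D w" "(x, y) \<in> ?D" for w x y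
    using that by (auto simp: C1_on_def partial_x_def partial_y_def DERIV_deriv_iff_field_differentiable)
  have C1: "C1_on ?D u" "C1_on ?D (partial_x u)" "C1_on ?D (partial_y u)" using C2 by (auto simp: C2_on_def)
  have cs: "continuous_on ?D (?s w)" if "continuous_on ?D w" for w
    using continuous_on_swap_args[OF that[unfolded square_domain_def]] by (simp add: square_domain_def case_prod_unfold)
  have sw: "sine_coeff m n (\<lambda>z. ?s w (dilate_pair r z)) = sine_coeff n m (\<lambda>z. w (dilate_pair r z))"
    if "0 < r" "r < 1" "continuous_on ?D w" for r w
    using sine_coeff_swap[OF continuous_on_dilate_pair[OF that], of m n]
    by (simp add: dilate_pair_def case_prod_unfold)
  \<comment> \<open>The paired equation multiplied by \<open>r ^ 2\<close>, with the side terms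
    retained; at \<open>r = 1\<close> only the claimed product is left.\<close>
  define F where "F = (\<lambda>r. (r\<^sup>2 * l - (real n)\<^sup>2 - (real m)\<^sup>2) * sine_coeff n m (\<lambda>z. u (dilate_pair r z))
     + real n * edge_coeff n m r u + real m * edge_coeff m n r (?s u))"
  have F0: "F r = 0" if r: "r \<in> {0<..<1}" for r
  proof -
    have r': "0 < r" "r < 1" using r by auto
    let ?c = "\<lambda>w. sine_coeff n m (\<lambda>z. w (dilate_pair r z))"
    have X: "r\<^sup>2 * ?c (partial_x (partial_x u)) = - (real n)\<^sup>2 * ?c u + real n * edge_coeff n m r u"
      by (rule sine_coeff_second_derivative[OF r' dx[OF C1(1)] dx[OF C1(2)] cD cxx])
    \<comment> \<open>The \<open>y\<close>-derivatives are treated by exchanging the coordinates,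
      which exchanges \<open>n\<close> and \<open>m\<close> as well.\<close>
    have "r\<^sup>2 * sine_coeff m n (\<lambda>z. ?s (partial_y (partial_y u)) (dilate_pair r z)) =
      - (real m)\<^sup>2 * sine_coeff m n (\<lambda>z. ?s u (dilate_pair r z)) + real m * edge_coeff m n r (?s u)"
      by (rule sine_coeff_second_derivative[OF r' _ _ cs[OF cD] cs[OF cyy], of "?s (partial_y u)"])
        (use dy[OF C1(1)] dy[OF C1(3)] in \<open>auto simp: square_domain_def\<close>)
    hence Y: "r\<^sup>2 * ?c (partial_y (partial_y u)) = - (real m)\<^sup>2 * ?c u + real m * edge_coeff m n r (?s u)"
      by (simp add: sw r' cD cyy)
    note cc = continuous_on_dilate_pair[OF r']
    have "0 = ?c (\<lambda>z. laplacian u z + l * u z)"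
    proof -
      have "dilate_pair r z \<in> ?D" if "z \<in> closed_square" for z
        using that dilate_mem_open[OF r'] by (auto simp: dilate_pair_def square_domain_def)
      hence "?c (\<lambda>z. laplacian u z + l * u z) = sine_coeff n m (\<lambda>z. 0)"
        using pde by (intro sine_coeff_cong) blast
      thus ?thesis by simp
    qed
    also have "\<dots> = ?c (partial_x (partial_x u)) + ?c (partial_y (partial_y u)) + l * ?c u"
      unfolding laplacian_def
      by (simp add: sine_coeff_add cc cxx cyy cD continuous_intros)
    finally have "r\<^sup>2 * ?c (partial_x (partial_x u)) + r\<^sup>2 * ?c (partial_y (partial_y u)) + r\<^sup>2 * l * ?c u = 0"
      by (metis distrib_left mult.assoc mult_zero_right)
    thus ?thesis unfolding X Y F_def by (simp add: algebra_simps)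
  qed
  have cs2: "continuous_on closed_square (?s u)"
    using continuous_on_swap_args[OF c] by (simp add: case_prod_unfold)
  have "continuous_on {0..1} F"
    unfolding F_def
    by (intro continuous_intros continuous_on_sine_coeff_dilate continuous_on_edge_coeff c cs2)
  \<comment> \<open>A continuous function on the closed interval that vanishes in the interior
    vanishes at the endpoint 1.\<close>
  hence "F 1 = 0"
    using continuous_constant_on_closure[of "{0<..<1}" F 0 1] F0 by (simp add: closure_greaterThanLessThan)
  moreover have "edge_coeff n m 1 u = 0" "edge_coeff m n 1 (?s u) = 0"
  proof -
    have "u (0, y) = 0" "u (pi, y) = 0" "u (y, 0) = 0" "u (y, pi) = 0" if "y \<in> {0..pi}" for y
      using that by (auto intro!: bd simp: square_domain_def)
    hence "edge_coeff n m 1 u = integral {0..pi} (\<lambda>y. 0)" "edge_coeff m n 1 (?s u) = integral {0..pi} (\<lambda>y. 0)"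
      unfolding edge_coeff_def by (intro integral_cong; simp)+
    thus "edge_coeff n m 1 u = 0" "edge_coeff m n 1 (?s u) = 0" by simp_all
  qed
  ultimately show ?thesis by (simp add: F_def dilate_pair_def)
qed

section \<open>The eigenspaces\<close>

text \<open>Differentiation is local, so a formula valid only on the open set \<open>S\<close>
  suffices. The formulas obtained for the partial derivatives let the lemma be applied to them
  again, which yields second derivatives.\<close>

lemma C1_on_explicit:
  assumes S: "open S" and eq: "\<And>z. z \<in> S \<Longrightarrow> u z = g z"
    and dx: "\<And>x y. (x, y) \<in> S \<Longrightarrow> ((\<lambda>t. g (t, y)) has_real_derivative gx (x, y)) (at x)"
    and dy: "\<And>x y. (x, y) \<in> S \<Longrightarrow> ((\<lambda>t. g (x, t)) has_real_derivative gy (x, y)) (at y)"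
    and gx: "continuous_on S gx" and gy: "continuous_on S gy"
  shows "C1_on S u" "\<And>z. z \<in> S \<Longrightarrow> partial_x u z = gx z" "\<And>z. z \<in> S \<Longrightarrow> partial_y u z = gy z"
proof -
  have ux: "((\<lambda>t. u (t, y)) has_real_derivative gx (x, y)) (at x)" if "(x, y) \<in> S" for x y
  proof (rule has_field_derivative_transform_within_open[OF dx[OF that]])
    show "open ((\<lambda>t. (t, y)) -` S)" by (intro open_vimage S continuous_intros)
  qed (use that eq in auto)
  have uy: "((\<lambda>t. u (x, t)) has_real_derivative gy (x, y)) (at y)" if "(x, y) \<in> S" for x y
  proof (rule has_field_derivative_transform_within_open[OF dy[OF that]])
    show "open ((\<lambda>t. (x, t)) -` S)" by (intro open_vimage S continuous_intros)
  qed (use that eq in auto)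
  show px: "partial_x u z = gx z" if "z \<in> S" for z
    using ux that by (cases z) (auto simp: partial_x_def intro: DERIV_imp_deriv)
  show py: "partial_y u z = gy z" if "z \<in> S" for z
    using uy that by (cases z) (auto simp: partial_y_def intro: DERIV_imp_deriv)
  have "continuous_on S (partial_x u)" "continuous_on S (partial_y u)"
    using gx gy px py by (simp_all cong: continuous_on_cong)
  thus "C1_on S u" using ux uy unfolding C1_on_def field_differentiable_def by blast
qed

text \<open>The value 0 outside the closed square is the normalisation that
  \<open>dirichlet_eigenspace\<close> demands of its elements.\<close>

definition sine_mode :: "nat \<times> nat \<Rightarrow> real \<times> real \<Rightarrow> real" where
  "sine_mode = (\<lambda>(n, m) (x, y). if (x, y) \<in> closed_square then sin (real n * x) * sin (real m * y) else 0)"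

lemma continuous_on_sine_mode: "continuous_on closed_square (sine_mode p)"
proof -
  have "continuous_on closed_square (\<lambda>(x, y). sin (real (fst p) * x) * sin (real (snd p) * y))"
    unfolding case_prod_unfold by (intro continuous_intros)
  thus ?thesis
    by (rule continuous_on_cong[THEN iffD1, rotated 2]) (auto simp: sine_mode_def split: prod.splits)
qed

lemma sine_mode_eigenspace: "sine_mode (n, m) \<in> dirichlet_eigenspace ((real n)\<^sup>2 + (real m)\<^sup>2)"
proof -
  let ?D = square_domain and ?n = "real n" and ?m = "real m"
  let ?u = "sine_mode (n, m)"
  \<comment> \<open>The partial derivatives used below stay among these four products, only the
    constant \<open>c\<close> changing.\<close>
  let ?ss = "\<lambda>c (x, y). c * (sin (?n * x) * sin (?m * y))"
  let ?cs = "\<lambda>c (x, y). c * (cos (?n * x) * sin (?m * y))"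
  let ?sc = "\<lambda>c (x, y). c * (sin (?n * x) * cos (?m * y))"
  let ?cc = "\<lambda>c (x, y). c * (cos (?n * x) * cos (?m * y))"
  have cont: "continuous_on S (?ss c)" "continuous_on S (?cs c)" "continuous_on S (?sc c)" "continuous_on S (?cc c)" for S c
    unfolding case_prod_unfold by (intro continuous_intros)+
  have eq: "?u z = ?ss 1 z" if "z \<in> ?D" for z
    using that by (auto simp: sine_mode_def square_domain_def)
  note 1 = C1_on_explicit[OF open_square_domain eq, where gx = "?cs ?n" and gy = "?sc ?m"]
  have u: "C1_on ?D ?u" "\<And>z. z \<in> ?D \<Longrightarrow> partial_x ?u z = ?cs ?n z" "\<And>z. z \<in> ?D \<Longrightarrow> partial_y ?u z = ?sc ?m z"
    by (rule 1; (rule cont | force intro!: derivative_eq_intros))+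
  note 2 = C1_on_explicit[OF open_square_domain u(2), where gx = "?ss (- ?n\<^sup>2)" and gy = "?cc (?n * ?m)"]
  have ux: "C1_on ?D (partial_x ?u)" "\<And>z. z \<in> ?D \<Longrightarrow> partial_x (partial_x ?u) z = ?ss (- ?n\<^sup>2) z"
    by (rule 2; (rule cont | force intro!: derivative_eq_intros simp: power2_eq_square))+
  note 3 = C1_on_explicit[OF open_square_domain u(3), where gx = "?cc (?n * ?m)" and gy = "?ss (- ?m\<^sup>2)"]
  have uy: "C1_on ?D (partial_y ?u)" "\<And>z. z \<in> ?D \<Longrightarrow> partial_y (partial_y ?u) z = ?ss (- ?m\<^sup>2) z"
    by (rule 3; (rule cont | force intro!: derivative_eq_intros simp: power2_eq_square))+
  have pde: "laplacian ?u z + (?n\<^sup>2 + ?m\<^sup>2) * ?u z = 0" if "z \<in> ?D" for z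
    using that by (cases z) (simp add: laplacian_def ux uy eq algebra_simps)
  have bd: "?u z = 0" if z: "z \<in> closed_square - ?D" for z
  proof -
    obtain x y where xy: "z = (x, y)" by fastforce
    hence "x = 0 \<or> x = pi \<or> y = 0 \<or> y = pi" using z by (auto simp: square_domain_def)
    thus ?thesis using z xy by (auto simp: sine_mode_def)
  qed
  show ?thesis
    using u(1) ux(1) uy(1) pde bd continuous_on_sine_mode
    by (auto simp: dirichlet_eigenspace_def dirichlet_solution_def C2_on_def closure_square_domain
        frontier_square_domain sine_mode_def)
qed

section \<open>Orthogonality of the product sines\<close>

text \<open>The frequency is an integer because it will be a difference of two natural
  numbers.\<close>

lemma integral_cos_int_mult:
  fixes k :: int
  shows "integral {0..pi} (\<lambda>x. cos (real_of_int k * x)) = (if k = 0 then pi else 0)"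
proof (cases "k = 0")
  case False
  have "((\<lambda>x. cos (real_of_int k * x)) has_integral sin (real_of_int k * pi) / real_of_int k - sin (real_of_int k * 0) / real_of_int k) {0..pi}"
    by (rule fundamental_theorem_of_calculus)
      (use False in \<open>auto intro!: derivative_eq_intros simp flip: has_real_derivative_iff_has_vector_derivative\<close>)
  moreover have "sin (real_of_int k * pi) = 0" using sin_integer_2pi sin_zero_iff_int2 by blast
  ultimately show ?thesis using False by (simp add: integral_unique)
qed simp

lemma integral_sin_mult_sin:
  assumes "0 < n"
  shows "integral {0..pi} (\<lambda>x. sin (real n' * x) * sin (real n * x)) = (if n = n' then pi / 2 else 0)"
proof -
  have e: "sin (real n' * x) * sin (real n * x) =
    (cos (real_of_int (int n' - int n) * x) - cos (real_of_int (int n' + int n) * x)) / 2" for x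
    using sin_times_sin[of "real n' * x" "real n * x"] by (simp add: algebra_simps)
  have c: "(\<lambda>x. cos (real_of_int k * x)) integrable_on {0..pi}" for k
    by (intro integrable_continuous_real continuous_intros)
  \<comment> \<open>The sum frequency therefore contributes nothing, and the difference frequency
    contributes only for \<open>n = n'\<close>.\<close>
  have "int n' + int n \<noteq> 0" using assms by linarith
  thus ?thesis unfolding e integral_divide integral_diff[OF c c] integral_cos_int_mult by simp
qed

lemma sine_coeff_sine_mode:
  assumes "0 < n" "0 < m"
  shows "sine_coeff n m (sine_mode p) = (if p = (n, m) then pi\<^sup>2 / 4 else 0)"
proof -
  obtain n' m' where p: "p = (n', m')" by fastforce
  have "sine_coeff n m (sine_mode p) = sine_coeff n m (\<lambda>(x, y). sin (real n' * x) * sin (real m' * y))"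
    by (rule sine_coeff_cong) (auto simp: p sine_mode_def)
  also have "\<dots> = integral {0..pi} (\<lambda>y. integral {0..pi} (\<lambda>x. sin (real n' * x) * sin (real n * x))
      * (sin (real m' * y) * sin (real m * y)))"
    unfolding sine_coeff_def
    by (simp add: algebra_simps flip: integral_mult_left integral_mult_right)
  also have "\<dots> = (if p = (n, m) then pi\<^sup>2 / 4 else 0)"
    using assms by (simp add: integral_sin_mult_sin p power2_eq_square)
  finally show ?thesis .
qed

section \<open>Basis and dimension of the eigenspace\<close>

lemma sum_fun_apply: "(\<Sum>a\<in>A. f a) z = (\<Sum>a\<in>A. f a z)"
  by (induction A rule: infinite_finite_induct) simp_all

lemma finite_pos_reps: "finite (pos_reps N)"
proof (rule finite_subset)
  have "n \<le> n\<^sup>2" for n :: nat by (simp add: power2_eq_square)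
  thus "pos_reps N \<subseteq> {..N} \<times> {..N}" unfolding pos_reps_def
    by (auto intro: order_trans trans_le_add1 trans_le_add2)
qed simp

lemma pos_reps_eigenvalue: "(n, m) \<in> pos_reps N \<longleftrightarrow> 0 < n \<and> 0 < m \<and> (real n)\<^sup>2 + (real m)\<^sup>2 = real N"
  by (auto simp: pos_reps_def) (metis of_nat_add of_nat_eq_iff of_nat_power)

text \<open>The coefficient at \<open>p\<close> is nonzero for \<open>sine_mode p\<close> and zero
  for every other mode.\<close>

lemma inj_on_sine_mode: "inj_on sine_mode (pos_reps N)"
proof (rule inj_onI)
  fix p q assume p: "p \<in> pos_reps N" and "sine_mode p = sine_mode q"
  hence "sine_coeff (fst p) (snd p) (sine_mode q) = pi\<^sup>2 / 4"
    using sine_coeff_sine_mode[of "fst p" "snd p" p] by (cases p) (auto simp: pos_reps_def)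
  thus "p = q" using p sine_coeff_sine_mode[of "fst p" "snd p" q]
    by (cases p) (auto simp: pos_reps_def split: if_splits)
qed

text \<open>Taking the coefficient at \<open>p\<close> of a vanishing combination isolates the
  scalar of \<open>sine_mode p\<close>, by orthogonality.\<close>

lemma independent_sine_modes: "real_fun.independent (sine_mode ` pos_reps N)"
proof (rule real_fun.independent_if_scalars_zero)
  show "finite (sine_mode ` pos_reps N)" using finite_pos_reps by simp
next
  fix f v assume s: "(\<Sum>v\<in>sine_mode ` pos_reps N. fun_scale (f v) v) = 0" and "v \<in> sine_mode ` pos_reps N"
  then obtain p where p: "v = sine_mode p" "p \<in> pos_reps N" by blast
  let ?c = "sine_coeff (fst p) (snd p)"
  have pos: "0 < fst p" "0 < snd p" using p by (auto simp: pos_reps_def)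
  have "(\<Sum>q\<in>pos_reps N. fun_scale (f (sine_mode q)) (sine_mode q)) = 0"
    using s by (simp add: sum.reindex inj_on_sine_mode)
  hence "(\<Sum>q\<in>pos_reps N. f (sine_mode q) * sine_mode q z) = 0" for z
    by (metis (no_types, lifting) sum_fun_apply fun_scale_def sum.cong zero_fun_apply)
  hence "0 = ?c (\<lambda>z. \<Sum>q\<in>pos_reps N. f (sine_mode q) * sine_mode q z)" by simp
  also have "\<dots> = (\<Sum>q\<in>pos_reps N. f (sine_mode q) * ?c (sine_mode q))"
    by (subst sine_coeff_sum) (auto intro!: continuous_intros continuous_on_sine_mode finite_pos_reps)
  also have "\<dots> = (\<Sum>q\<in>pos_reps N. if q = p then f v * (pi\<^sup>2 / 4) else 0)"
    using p by (intro sum.cong) (auto simp: sine_coeff_sine_mode[OF pos])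
  also have "\<dots> = f v * (pi\<^sup>2 / 4)" using p finite_pos_reps by simp
  finally show "f v = 0" by simp
qed

text \<open>Only coefficients indexed by \<open>pos_reps N\<close> can be nonzero. Removing the
  corresponding finite sine expansion leaves a continuous function with no positive-index
  coefficients, which is zero by completeness.\<close>

lemma dirichlet_eigenspace_subset_span:
  "dirichlet_eigenspace (real N) \<subseteq> real_fun.span (sine_mode ` pos_reps N)"
proof
  fix u assume u: "u \<in> dirichlet_eigenspace (real N)"
  have sol: "dirichlet_solution (real N) u" and out: "\<And>z. z \<notin> closed_square \<Longrightarrow> u z = 0"
    using u unfolding dirichlet_eigenspace_def closure_square_domain by blast+
  have cu: "continuous_on closed_square u"
    using sol by (simp add: dirichlet_solution_def closure_square_domain)
  \<comment> \<open>\<open>4 / pi ^ 2\<close> inverts the coefficient of a mode at its own index;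
    the minus sign makes \<open>u z + ?w z\<close> the remainder.\<close>
  define c where "c = (\<lambda>p. - (4 / pi\<^sup>2) * sine_coeff (fst p) (snd p) u)"
  let ?w = "\<lambda>z. \<Sum>p\<in>pos_reps N. c p * sine_mode p z"
  have cw: "continuous_on closed_square ?w"
    by (intro continuous_intros continuous_on_sine_mode)
  have "sine_coeff n m (\<lambda>z. u z + ?w z) = 0" if nm: "0 < n" "0 < m" for n m
  proof -
    have "sine_coeff n m ?w = (\<Sum>p\<in>pos_reps N. c p * sine_coeff n m (sine_mode p))"
      by (subst sine_coeff_sum) (auto intro!: continuous_intros continuous_on_sine_mode finite_pos_reps)
    also have "\<dots> = (\<Sum>p\<in>pos_reps N. if p = (n, m) then c p * (pi\<^sup>2 / 4) else 0)"
      by (intro sum.cong) (auto simp: sine_coeff_sine_mode[OF nm])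
    also have "\<dots> = (if (n, m) \<in> pos_reps N then - sine_coeff n m u else 0)"
      using finite_pos_reps by (simp add: c_def)
    also have "\<dots> = - sine_coeff n m u"
      using sine_coeff_dirichlet_solution[OF sol, of n m] nm by (auto simp: pos_reps_eigenvalue)
    finally show ?thesis by (simp add: sine_coeff_add cu cw)
  qed
  hence "u z + ?w z = 0" if "z \<in> closed_square" for z
    using sine_coeff_complete[OF continuous_on_add[OF cu cw]] that by blast
  moreover have "u z + ?w z = 0" if "z \<notin> closed_square" for z
    using that out[OF that] by (auto simp: sine_mode_def split: prod.splits intro!: sum.neutral)
  ultimately have "u z = (\<Sum>p\<in>pos_reps N. fun_scale (- c p) (sine_mode p)) z" for z
    by (cases "z \<in> closed_square") (simp_all add: sum_fun_apply fun_scale_def sum_negf eq_neg_iff_add_eq_0)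
  hence "u = (\<Sum>p\<in>pos_reps N. fun_scale (- c p) (sine_mode p))" by blast
  moreover have "\<dots> \<in> real_fun.span (sine_mode ` pos_reps N)"
    by (intro real_fun.span_sum real_fun.span_scale real_fun.span_base imageI)
  ultimately show "u \<in> real_fun.span (sine_mode ` pos_reps N)" by (simp only:)
qed

text \<open>The modes indexed by \<open>pos_reps N\<close> form a basis of the eigenspace, and
  distinct indices give distinct modes.\<close>

lemma eigen_multiplicity_eq_card_pos_reps: "eigen_multiplicity (real N) = card (pos_reps N)"
  unfolding eigen_multiplicity_def
proof (rule real_fun.dim_unique[OF _ dirichlet_eigenspace_subset_span independent_sine_modes])
  show "sine_mode ` pos_reps N \<subseteq> dirichlet_eigenspace (real N)"
    using sine_mode_eigenspace by (auto simp: pos_reps_eigenvalue) metis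
  show "card (sine_mode ` pos_reps N) = card (pos_reps N)" by (rule card_image[OF inj_on_sine_mode])
qed

lemma dirichlet_eigenvalue_pos_reps:
  assumes "pos_reps N \<noteq> {}"
  shows "dirichlet_eigenvalue (real N)"
proof -
  obtain n m where nm: "(n, m) \<in> pos_reps N" using assms by auto
  hence "sine_coeff n m (sine_mode (n, m)) \<noteq> 0"
    by (simp add: sine_coeff_sine_mode pos_reps_def)
  hence "sine_mode (n, m) \<noteq> (\<lambda>z. 0)" by (metis sine_coeff_zero)
  moreover have "sine_mode (n, m) \<in> dirichlet_eigenspace (real N)"
    using sine_mode_eigenspace[of n m] nm by (simp add: pos_reps_eigenvalue)
  ultimately show ?thesis by (auto simp: dirichlet_eigenvalue_def)
qed

lemma eigenvalue_multiplicity: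
  assumes "card (pos_reps N) = j" "0 < j"
  shows "dirichlet_eigenvalue (real N) \<and> eigen_multiplicity (real N) = j"
  using assms dirichlet_eigenvalue_pos_reps[of N] eigen_multiplicity_eq_card_pos_reps[of N]
  by (cases "pos_reps N = {}") simp_all

section \<open>Eigenvalues of prescribed multiplicity\<close>

theorem theorem2p1:
  shows
    "(\<forall>k::nat. k \<ge> 1 \<longrightarrow>
        (\<exists>N::real. dirichlet_eigenvalue N \<and> eigen_multiplicity N = 2 * k) \<and>
        (\<forall>p1 p2 :: nat. prime p1 \<and> prime p2 \<and> p1 \<noteq> p2 \<and> [p1 = 1] (mod 4) \<and> [p2 = 1] (mod 4) \<longrightarrow>
           dirichlet_eigenvalue (real (p1 * p2 ^ (k - 1))) \<and>
           eigen_multiplicity (real (p1 * p2 ^ (k - 1))) = 2 * k))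
     \<and>
     (\<forall>k::nat. k \<ge> 1 \<longrightarrow>
        (\<exists>M::real. dirichlet_eigenvalue M \<and> eigen_multiplicity M = 2 * k + 1) \<and>
        (\<forall>p :: nat. prime p \<and> [p = 1] (mod 4) \<longrightarrow>
           dirichlet_eigenvalue (real (2 * p ^ (2 * k))) \<and>
           eigen_multiplicity (real (2 * p ^ (2 * k))) = 2 * k + 1))"
proof -
  have even: "dirichlet_eigenvalue (real (p1 * p2 ^ (k - 1))) \<and>
      eigen_multiplicity (real (p1 * p2 ^ (k - 1))) = 2 * k"
    if "k \<ge> 1" "prime p1 \<and> prime p2 \<and> p1 \<noteq> p2 \<and> [p1 = 1] (mod 4) \<and> [p2 = 1] (mod 4)"
    for p1 p2 k :: nat
  proof (rule eigenvalue_multiplicity)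
    show "card (pos_reps (p1 * p2 ^ (k - 1))) = 2 * k" using that by (intro card_pos_reps_even) simp_all
    show "0 < 2 * k" using that by simp
  qed
  have odd: "dirichlet_eigenvalue (real (2 * p ^ (2 * k))) \<and>
      eigen_multiplicity (real (2 * p ^ (2 * k))) = 2 * k + 1"
    if "prime p \<and> [p = 1] (mod 4)" for p k :: nat
  proof (rule eigenvalue_multiplicity)
    show "card (pos_reps (2 * p ^ (2 * k))) = 2 * k + 1" using that by (intro card_pos_reps_odd) simp_all
  qed simp
  \<comment> \<open>5 and 13 provide concrete witnesses for the existence claims; 5 alone serves the
    odd case.\<close>
  have primes: "prime (5::nat) \<and> prime (13::nat) \<and> (5::nat) \<noteq> 13 \<and> [5 = 1] (mod (4::nat)) \<and> [13 = 1] (mod (4::nat))"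
    by (simp add: cong_def)
  have prime5: "prime (5::nat) \<and> [5 = 1] (mod (4::nat))"
    using primes by (elim conjE) (intro conjI)
  show ?thesis
  proof (rule conjI; intro allI impI)
    fix k :: nat assume k: "k \<ge> 1"
    show "(\<exists>N. dirichlet_eigenvalue N \<and> eigen_multiplicity N = 2 * k) \<and>
        (\<forall>p1 p2 :: nat. prime p1 \<and> prime p2 \<and> p1 \<noteq> p2 \<and> [p1 = 1] (mod 4) \<and> [p2 = 1] (mod 4) \<longrightarrow>
           dirichlet_eigenvalue (real (p1 * p2 ^ (k - 1))) \<and>
           eigen_multiplicity (real (p1 * p2 ^ (k - 1))) = 2 * k)"
      by (rule conjI, rule exI, rule even[OF k primes], intro allI impI, rule even[OF k])
    show "(\<exists>M. dirichlet_eigenvalue M \<and> eigen_multiplicity M = 2 * k + 1) \<and>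
        (\<forall>p :: nat. prime p \<and> [p = 1] (mod 4) \<longrightarrow>
           dirichlet_eigenvalue (real (2 * p ^ (2 * k))) \<and>
           eigen_multiplicity (real (2 * p ^ (2 * k))) = 2 * k + 1)"
      by (rule conjI, rule exI, rule odd[OF prime5], intro allI impI, rule odd)
  qed
qed

end
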